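(* Let $G$ and $G'$ be two graphs on the same set $V$ of $v$ vertices. Let $p$ be a prime number and $k$ an integer with $3\leq k\leq v-3$. 1) If $h^{(3)}(G_{\restriction K})=h^{(3)}(G'_{\restriction K})$ for all $k$-element subsets $K$ of $V$, then $G$ and $G'$ have the same $3$-element homogeneous sets. 2) Assume $p\geq 5$. If $k\not\equiv 1,2 \pmod p$ and $h^{(3)}(G_{\restriction K})\equiv h^{(3)}(G'_{\restriction K}) \pmod p$ for all $k$-element subsets $K$ of $V$, then $G$ and $G'$ have the same $3$-element homogeneous sets. 3) If ($p=2$ and $k\equiv 3 \pmod 4$) or ($p=3$ and $3\mid k$), and $h^{(3)}(G_{\restriction K})\equiv h^{(3)}(G'_{\restriction K}) \pmod p$ for all $k$-element subsets $K$ of $V$, then $G$ and $G'$ have the same $3$-element homogeneous sets.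
   Context: Graphs are simple undirected graphs. $G_{\restriction K}$ denotes the induced subgraph on $K$. A $3$-element subset of $V$ is a $3$-homogeneous set of $G$ if it induces a triangle in $G$ or in the complement $\overline{G}$ (i.e. all three pairs are edges, or none is). $h^{(3)}(G)$ is the number of $3$-homogeneous subsets of $G$. *)

theory Defs
  imports "HOL-Library.Ramsey" "HOL-Number_Theory.Cong"
begin

type_synonym 'a graph = "'a set \<times> 'a set set"

abbreviation verts :: "'a graph \<Rightarrow> 'a set" where
  "verts \<equiv> fst"

abbreviation edges :: "'a graph \<Rightarrow> 'a set set" where
  "edges \<equiv> snd"

definition simple_graph :: "'a graph \<Rightarrow> bool" where
  "simple_graph G \<longleftrightarrow> edges G \<subseteq> [verts G]\<^bsup>2\<^esup>"

definition induced_subgraph :: "'a graph \<Rightarrow> 'a set \<Rightarrow> 'a graph" where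
  "induced_subgraph G K = (K, edges G \<inter> [K]\<^bsup>2\<^esup>)"

definition complement_graph :: "'a graph \<Rightarrow> 'a graph" where
  "complement_graph G = (verts G, [verts G]\<^bsup>2\<^esup> - edges G)"

definition homogeneous3 :: "'a graph \<Rightarrow> 'a set set" where
  "homogeneous3 G =
     {T \<in> [verts G]\<^bsup>3\<^esup>. clique T (edges G) \<or> clique T (edges (complement_graph G))}"

definition h3 :: "'a graph \<Rightarrow> nat" where
  "h3 G = card (homogeneous3 G)"

end

theory Submission
  imports Defs
begin

text \<open>
  Let \<open>f\<close> be an integer function on the \<open>t\<close>-subsets of \<open>V\<close> whose sum over the \<open>t\<close>-subsets of every
  \<open>k\<close>-set vanishes modulo \<open>m\<close>. Comparing the \<open>k\<close>-sets \<open>S \<union> {x}\<close> and \<open>S \<union> {y}\<close> shows that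
  \<open>U \<mapsto> f (U \<union> {x}) - f (U \<union> {y})\<close> satisfies the same condition on \<open>V - {x, y}\<close> with \<open>(t - 1, k - 1)\<close>
  in place of \<open>(t, k)\<close>. By induction this difference is constant, and the constant times
  \<open>k - 1 choose t - 1\<close> is zero modulo \<open>m\<close>; so it vanishes and \<open>f\<close> is constant modulo \<open>m\<close>.
  This elementary argument replaces Wilson's rank formula for incidence matrices.
  For \<open>t = 3\<close> and \<open>f\<close> the difference of the indicators of the two families of homogeneous sets,
  a nonzero constant is impossible because a graph on at least six vertices has a homogeneous
  triple. The modulus is \<open>0\<close> in part 1 and \<open>p\<close> in parts 2 and 3. For \<open>p = 2\<close> congruence does not
  determine a value in \<open>{-1, 0, 1}\<close>, and one uses that \<open>k choose 3\<close> is odd to make \<open>f\<close> even.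
\<close>

section \<open>Sums over the subsets of a fixed size\<close>

lemma nsets_iff: "finite A \<Longrightarrow> T \<in> [A]\<^bsup>n\<^esup> \<longleftrightarrow> T \<subseteq> A \<and> card T = n"
  by (auto simp: nsets_def intro: finite_subset)

lemma sum_nsets_insert:
  fixes f :: "'a set \<Rightarrow> 'b::comm_monoid_add"
  assumes "finite S" "x \<notin> S"
  shows "(\<Sum>T\<in>[insert x S]\<^bsup>Suc n\<^esup>. f T) = (\<Sum>T\<in>[S]\<^bsup>Suc n\<^esup>. f T) + (\<Sum>U\<in>[S]\<^bsup>n\<^esup>. f (insert x U))"
proof -
  have split: "[insert x S]\<^bsup>Suc n\<^esup> = [S]\<^bsup>Suc n\<^esup> \<union> insert x ` [S]\<^bsup>n\<^esup>"
  proof (rule set_eqI)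
    fix T
    have "T \<in> insert x ` [S]\<^bsup>n\<^esup>" if "T \<in> [insert x S]\<^bsup>Suc n\<^esup>" "x \<in> T"
    proof (rule image_eqI)
      show "T = insert x (T - {x})" using that by blast
      show "T - {x} \<in> [S]\<^bsup>n\<^esup>"
        using that by (auto simp: nsets_def)
    qed
    then show "T \<in> [insert x S]\<^bsup>Suc n\<^esup> \<longleftrightarrow> T \<in> [S]\<^bsup>Suc n\<^esup> \<union> insert x ` [S]\<^bsup>n\<^esup>"
      using assms by (auto simp: nsets_def card_insert_if)
  qed
  have inj: "inj_on (insert x) ([S]\<^bsup>n\<^esup>)"
    using assms(2) by (intro inj_onI) (metis (no_types, lifting) insert_ident mem_Collect_eq nsets_def subsetD)
  have "[S]\<^bsup>Suc n\<^esup> \<inter> insert x ` [S]\<^bsup>n\<^esup> = {}"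
    using assms(2) by (auto simp: nsets_def)
  then show ?thesis
    unfolding split using assms(1)
    by (simp add: sum.union_disjoint finite_imp_finite_nsets sum.reindex[OF inj])
qed

text \<open>Exchanging one element of \<open>T - T'\<close> at a time for one of
  \<open>T' - T\<close> leads from \<open>T\<close> to \<open>T'\<close>; by \<open>swap\<close>
  each exchange changes \<open>f\<close> by a multiple of \<open>m\<close>.\<close>

lemma dvd_diff_nsets:
  fixes f :: "'a set \<Rightarrow> int"
  assumes "finite V"
    and swap: "\<And>x y U. \<lbrakk>x \<in> V; y \<in> V; x \<noteq> y; U \<in> [V - {x, y}]\<^bsup>t\<^esup>\<rbrakk>
      \<Longrightarrow> m dvd f (insert x U) - f (insert y U)"
    and "T \<in> [V]\<^bsup>Suc t\<^esup>" "T' \<in> [V]\<^bsup>Suc t\<^esup>"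
  shows "m dvd f T - f T'"
  using assms(3)
proof (induction "card (T - T')" arbitrary: T)
  case 0
  have fin: "finite T" "finite T'" and card: "card T = Suc t" "card T' = Suc t"
    using 0 assms(4) by (auto simp: nsets_def)
  have "T \<subseteq> T'" using 0 fin by auto
  then have "T = T'" using fin card by (simp add: card_subset_eq)
  then show ?case by simp
next
  case (Suc n)
  have T: "finite T" "T \<subseteq> V" "card T = Suc t" and T': "finite T'" "T' \<subseteq> V" "card T' = Suc t"
    using Suc.prems assms(4) by (auto simp: nsets_def)
  obtain x where x: "x \<in> T" "x \<notin> T'" using Suc.hyps(2) by (metis DiffE card_eq_SucD insertI1)
  obtain y where y: "y \<in> T'" "y \<notin> T" using T T' x by (metis card_subset_eq subsetI)
  define U where "U = T - {x}"
  have U: "U \<in> [V - {x, y}]\<^bsup>t\<^esup>" using T x y by (auto simp: U_def nsets_def)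
  have "insert y U - T' = T - T' - {x}" using y by (auto simp: U_def)
  then have "card (insert y U - T') = n" using Suc.hyps(2) x T by simp
  moreover have "insert y U \<in> [V]\<^bsup>Suc t\<^esup>"
    using U y T' by (auto simp: nsets_def card_insert_if)
  ultimately have "m dvd f (insert y U) - f T'" using Suc.hyps(1) by blast
  moreover have "m dvd f T - f (insert y U)"
    using swap[of x y U] x y U T T' by (auto simp: U_def insert_absorb)
  ultimately have "m dvd (f T - f (insert y U)) + (f (insert y U) - f T')" by (rule dvd_add[rotated])
  then show ?case by simp
qed

text \<open>Modulo \<open>m\<close> the sum equals \<open>card K choose t\<close> times
  \<open>c\<close>, and the binomial cancels by \<open>prime\<close>.\<close>

lemma dvd_const_sum_nsets:
  fixes f :: "'a set \<Rightarrow> int"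
  assumes prime: "\<And>a b. m dvd a * b \<Longrightarrow> m dvd a \<or> m dvd b"
    and "finite K" "\<not> m dvd int (card K choose t)"
    and sum: "m dvd (\<Sum>T\<in>[K]\<^bsup>t\<^esup>. f T)"
    and const: "\<And>T. T \<in> [K]\<^bsup>t\<^esup> \<Longrightarrow> m dvd f T - c"
  shows "m dvd c"
proof -
  have "m dvd (\<Sum>T\<in>[K]\<^bsup>t\<^esup>. f T - c)" using const by (rule dvd_sum)
  then have "m dvd (\<Sum>T\<in>[K]\<^bsup>t\<^esup>. f T) - int (card K choose t) * c"
    by (simp add: sum_subtractf)
  then have "m dvd int (card K choose t) * c" using sum by (simp add: dvd_diff_right_iff)
  then show ?thesis using prime assms(3) by blast
qed

text \<open>The hypothesis on \<open>m\<close> holds exactly for \<open>m = 0\<close>, units and prime elements.\<close>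

lemma nsets_sum_zero_imp_const:
  fixes f :: "'a set \<Rightarrow> int"
  assumes prime: "\<And>a b. m dvd a * b \<Longrightarrow> m dvd a \<or> m dvd b"
    and "finite V" "t \<le> k" "k + t \<le> card V"
    and "\<And>i. \<lbrakk>0 < i; i \<le> t\<rbrakk> \<Longrightarrow> \<not> m dvd int ((k - i) choose (t - i))"
    and "\<And>K. K \<in> [V]\<^bsup>k\<^esup> \<Longrightarrow> m dvd (\<Sum>T\<in>[K]\<^bsup>t\<^esup>. f T)"
    and "T \<in> [V]\<^bsup>t\<^esup>" "T' \<in> [V]\<^bsup>t\<^esup>"
  shows "m dvd f T - f T'"
  using assms(2-)
proof (induction t arbitrary: k V f T T')
  case 0
  then show ?case by simp
next
  case (Suc t)
  obtain k' where k: "k = Suc k'" using Suc.prems(2) by (cases k) auto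
  have "m dvd f (insert x U) - f (insert y U)"
    if xy: "x \<in> V" "y \<in> V" "x \<noteq> y" and U: "U \<in> [V - {x, y}]\<^bsup>t\<^esup>" for x y U
  proof -
    let ?W = "V - {x, y}"
    define g where "g U = f (insert x U) - f (insert y U)" for U
    have fin: "finite ?W" using Suc.prems(1) by simp
    have cardW: "card ?W = card V - 2"
      using xy Suc.prems(1) by (simp add: card_Diff_subset)
    have sum: "m dvd (\<Sum>U\<in>[S]\<^bsup>t\<^esup>. g U)" if S: "S \<in> [?W]\<^bsup>k'\<^esup>" for S
    proof -
      have S': "finite S" "x \<notin> S" "y \<notin> S" using S by (auto simp: nsets_def)
      have "insert x S \<in> [V]\<^bsup>k\<^esup>" "insert y S \<in> [V]\<^bsup>k\<^esup>"
        using S xy S' by (auto simp: nsets_def k)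
      then have "m dvd (\<Sum>T\<in>[insert x S]\<^bsup>Suc t\<^esup>. f T) - (\<Sum>T\<in>[insert y S]\<^bsup>Suc t\<^esup>. f T)"
        by (intro dvd_diff Suc.prems(5))
      then show ?thesis using S' by (simp add: sum_nsets_insert g_def sum_subtractf)
    qed
    have const: "m dvd g A - g B" if "A \<in> [?W]\<^bsup>t\<^esup>" "B \<in> [?W]\<^bsup>t\<^esup>" for A B
    proof (rule Suc.IH[OF fin _ _ _ sum that])
      \<comment> \<open>Removing \<open>x\<close> and \<open>y\<close> costs two vertices, exactly
        the drop from \<open>k + Suc t\<close> to \<open>k' + t\<close>.\<close>
      show "t \<le> k'" "k' + t \<le> card ?W" using Suc.prems(2,3) k cardW by auto
      \<comment> \<open>These are the binomials for \<open>(k, Suc t)\<close> with \<open>i\<close>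
        raised by one. The remaining case \<open>i = 1\<close> is what later turns constancy of
        \<open>g\<close> into vanishing.\<close>
      show "\<not> m dvd int ((k' - i) choose (t - i))" if "0 < i" "i \<le> t" for i
        using Suc.prems(4)[of "Suc i"] that by (simp add: k)
    qed
    have "k' \<le> card ?W" using Suc.prems(2,3) k cardW by linarith
    then obtain S where S: "S \<subseteq> ?W" "card S = k'" by (meson obtain_subset_with_card_n)
    have "m dvd g U"
    proof (rule dvd_const_sum_nsets[OF prime])
      show "finite S" using S fin finite_subset by blast
      show "\<not> m dvd int (card S choose t)" using Suc.prems(4)[of 1] by (simp add: S k)
      show "m dvd (\<Sum>U\<in>[S]\<^bsup>t\<^esup>. g U)" using S fin by (intro sum) (simp add: nsets_iff)
      show "m dvd g T - g U" if "T \<in> [S]\<^bsup>t\<^esup>" for T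
        using that S(1) nsets_mono const[OF _ U] by blast
    qed
    then show ?thesis by (simp add: g_def)
  qed
  then show ?case using dvd_diff_nsets[OF Suc.prems(1) _ Suc.prems(6,7)] by blast
qed

section \<open>The Ramsey bound R(3,3) \<le> 6\<close>

lemma clique_or_indep_of_star:
  assumes "x \<notin> S" "card S = 3" "\<And>s. s \<in> S \<Longrightarrow> {x, s} \<in> E"
  shows "\<exists>R\<in>[insert x S]\<^bsup>3\<^esup>. clique R E \<or> indep R E"
\<comment> \<open>Without an edge inside, \<open>S\<close> itself is the triple; otherwise an edge
  of \<open>S\<close> forms a triangle with \<open>x\<close>.\<close>
proof (cases "indep S E")
  case True
  then show ?thesis using assms by (intro bexI[of _ S]) (auto simp: nsets_def intro: card_ge_0_finite)
next
  case False
  then obtain a b where ab: "a \<in> S" "b \<in> S" "a \<noteq> b" "{a, b} \<in> E" by (auto simp: indep_def)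
  have "x \<noteq> a" "x \<noteq> b" using ab assms(1) by auto
  then have "{x, a, b} \<in> [insert x S]\<^bsup>3\<^esup>" using ab by (auto simp: nsets_def)
  moreover have "clique {x, a, b} E" using ab assms(3) by (auto simp: clique_def insert_commute)
  ultimately show ?thesis by blast
qed

text \<open>By pigeonhole, a vertex with at least five others has three neighbours or three
  non-neighbours.\<close>

lemma ramsey_3_3:
  assumes "finite V" "6 \<le> card V"
  shows "\<exists>R\<in>[V]\<^bsup>3\<^esup>. clique R E \<or> indep R E"
proof -
  obtain x where x: "x \<in> V" using assms by fastforce
  let ?N = "{y \<in> V - {x}. {x, y} \<in> E}" and ?M = "{y \<in> V - {x}. {x, y} \<in> - E}"
  have "?N \<union> ?M = V - {x}" by blast
  then have "5 \<le> card (?N \<union> ?M)" using assms x by simp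
  moreover have "card (?N \<union> ?M) \<le> card ?N + card ?M" by (rule card_Un_le)
  ultimately have "3 \<le> card ?N \<or> 3 \<le> card ?M" by linarith
  then consider S where "S \<subseteq> ?N" "card S = 3" | S where "S \<subseteq> ?M" "card S = 3"
    by (meson obtain_subset_with_card_n)
  then show ?thesis
  proof cases
    case (1 S)
    then have "\<exists>R\<in>[insert x S]\<^bsup>3\<^esup>. clique R E \<or> indep R E"
      by (intro clique_or_indep_of_star) auto
    moreover have "insert x S \<subseteq> V" using 1 x by auto
    ultimately show ?thesis using nsets_mono by blast
  next
    case (2 S)
    \<comment> \<open>In \<open>- E\<close> the non-neighbours form a star around \<open>x\<close>;
      complementing swaps \<open>clique\<close> and \<open>indep\<close>, so the conclusion is
      symmetric.\<close>
    then have "\<exists>R\<in>[insert x S]\<^bsup>3\<^esup>. clique R (- E) \<or> indep R (- E)"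
      by (intro clique_or_indep_of_star) auto
    then obtain R where R: "R \<in> [insert x S]\<^bsup>3\<^esup>" "clique R (- E) \<or> indep R (- E)" by blast
    then have "clique R E \<or> indep R E" by (auto simp: clique_def indep_def)
    moreover have "insert x S \<subseteq> V" using 2 x by auto
    ultimately show ?thesis using nsets_mono R(1) by blast
  qed
qed

section \<open>Homogeneous triples and their counts\<close>

lemma homogeneous3_eq:
  "homogeneous3 G = {T \<in> [verts G]\<^bsup>3\<^esup>. clique T (edges G) \<or> indep T (edges G)}"
  by (auto simp: homogeneous3_def complement_graph_def clique_def indep_def nsets_def)

lemma homogeneous3_induced_subgraph:
  assumes "K \<subseteq> verts G"
  shows "homogeneous3 (induced_subgraph G K) = homogeneous3 G \<inter> [K]\<^bsup>3\<^esup>"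
proof -
  have "clique T (edges G \<inter> [K]\<^bsup>2\<^esup>) = clique T (edges G)"
    "indep T (edges G \<inter> [K]\<^bsup>2\<^esup>) = indep T (edges G)" if "T \<subseteq> K" for T
    using that by (auto simp: clique_def indep_def)
  then show ?thesis
    using assms by (auto simp: homogeneous3_eq induced_subgraph_def nsets_def)
qed

lemma homogeneous3_nonempty:
  assumes "finite (verts G)" "6 \<le> card (verts G)"
  shows "homogeneous3 G \<noteq> {}"
  using ramsey_3_3[OF assms] by (auto simp: homogeneous3_eq)

lemma h3_induced_subgraph:
  assumes "finite K" "K \<subseteq> verts G"
  shows "int (h3 (induced_subgraph G K)) = (\<Sum>T\<in>[K]\<^bsup>3\<^esup>. of_bool (T \<in> homogeneous3 G))"
  using assms by (simp add: h3_def homogeneous3_induced_subgraph finite_imp_finite_nsets Int_commute)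

text \<open>The common core, applied with \<open>m = 0\<close> and \<open>m = p\<close>. The
  conditions before \<open>m\<close> say that \<open>m\<close> does not divide
  \<open>(k - i) choose (3 - i)\<close> for \<open>i = 1, 2, 3\<close>; the last binomial is 1,
  whence \<open>\<bar>m\<bar> \<noteq> 1\<close>.\<close>

lemma homogeneous3_eq_of_h3_dvd:
  fixes m :: int
  assumes "finite V" "verts G = V" "verts G' = V" "3 \<le> k" "k + 3 \<le> card V"
    and prime: "\<And>a b. m dvd a * b \<Longrightarrow> m dvd a \<or> m dvd b"
    and "\<bar>m\<bar> \<noteq> 1" "\<not> m dvd int (k - 2)" "\<not> m dvd int ((k - 1) choose 2)"
    and m: "\<bar>m\<bar> \<noteq> 2 \<or> \<not> m dvd int (k choose 3)"
    and h3: "\<And>K. K \<in> [V]\<^bsup>k\<^esup> \<Longrightarrow>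
      m dvd int (h3 (induced_subgraph G K)) - int (h3 (induced_subgraph G' K))"
  shows "homogeneous3 G = homogeneous3 G'"
proof -
  define f :: "'a set \<Rightarrow> int" where
    "f T = of_bool (T \<in> homogeneous3 G) - of_bool (T \<in> homogeneous3 G')" for T
  have sub: "homogeneous3 G \<subseteq> [V]\<^bsup>3\<^esup>" "homogeneous3 G' \<subseteq> [V]\<^bsup>3\<^esup>"
    using assms(2,3) by (auto simp: homogeneous3_eq)
  have sum: "m dvd (\<Sum>T\<in>[K]\<^bsup>3\<^esup>. f T)" if "K \<in> [V]\<^bsup>k\<^esup>" for K
    using h3[OF that] that assms(2,3)
    by (simp add: f_def sum_subtractf h3_induced_subgraph nsets_def)
  have const: "m dvd f T - f T'" if "T \<in> [V]\<^bsup>3\<^esup>" "T' \<in> [V]\<^bsup>3\<^esup>" for T T'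
  proof (rule nsets_sum_zero_imp_const[OF prime \<open>finite V\<close> assms(4,5) _ sum that])
    fix i :: nat
    assume "0 < i" "i \<le> 3"
    then consider "i = 1" | "i = 2" | "i = 3" by linarith
    then show "\<not> m dvd int ((k - i) choose (3 - i))"
      using assms(7-9) by cases auto
  qed
  have bound: "\<bar>f T\<bar> \<le> 1" for T by (simp add: f_def)
  have eq: "f T = f T'" if T: "T \<in> [V]\<^bsup>3\<^esup>" "T' \<in> [V]\<^bsup>3\<^esup>" for T T'
  \<comment> \<open>Values of \<open>f\<close> differ by at most 2, so congruent ones are equal
    unless \<open>\<bar>m\<bar> = 2\<close>. In that case 1 and -1 are congruent, and
    \<open>f\<close> is shown to be even, hence zero.\<close>
  proof (cases "\<bar>m\<bar> = 2")
    case True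
    obtain K where K: "K \<subseteq> V" "card K = k"
      using assms(5) by (meson add_leE obtain_subset_with_card_n)
    have "m dvd f T''" if "T'' \<in> [V]\<^bsup>3\<^esup>" for T''
    proof (rule dvd_const_sum_nsets[OF prime])
      show "finite K" using K assms(1) finite_subset by blast
      show "\<not> m dvd int (card K choose 3)" using m True K by simp
      show "m dvd (\<Sum>T\<in>[K]\<^bsup>3\<^esup>. f T)" using K assms(1) by (intro sum) (simp add: nsets_iff)
      show "m dvd f T - f T''" if "T \<in> [K]\<^bsup>3\<^esup>" for T
        using const[OF _ \<open>T'' \<in> [V]\<^bsup>3\<^esup>\<close>] nsets_mono[OF K(1)] that by blast
    qed
    moreover have "a = 0" if "m dvd a" "\<bar>a\<bar> \<le> 1" for a
      using dvd_imp_le_int[OF _ that(1)] that(2) True by auto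
    ultimately show ?thesis using T bound by metis
  next
    case False
    have "\<bar>f T - f T'\<bar> \<le> 2" using bound[of T] bound[of T'] by linarith
    moreover have "\<bar>m\<bar> \<le> \<bar>f T - f T'\<bar>" if "f T \<noteq> f T'"
      using dvd_imp_le_int[of "f T - f T'" m] const[OF T] that by simp
    moreover have "m \<noteq> 0" if "f T \<noteq> f T'" using const[OF T] that by auto
    ultimately show ?thesis using False \<open>\<bar>m\<bar> \<noteq> 1\<close> by linarith
  qed
  have six: "6 \<le> card V" using assms(4,5) by linarith
  obtain H where H: "H \<in> homogeneous3 G"
    using homogeneous3_nonempty[of G] assms(1,2) six by blast
  obtain H' where H': "H' \<in> homogeneous3 G'"
    using homogeneous3_nonempty[of G'] assms(1,3) six by blast
  \<comment> \<open>One value is nonnegative and one nonpositive, so the constant is zero.\<close>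
  have "0 \<le> f H" "f H' \<le> 0" using H H' by (simp_all add: f_def)
  moreover have "f H = f H'" using eq H H' sub by blast
  ultimately have "f H = 0" by simp
  then have zero: "f T = 0" if "T \<in> [V]\<^bsup>3\<^esup>" for T using eq[OF that, of H] H sub by auto
  have "T \<in> homogeneous3 G \<longleftrightarrow> T \<in> homogeneous3 G'" if "T \<in> [V]\<^bsup>3\<^esup>" for T
    using zero[OF that] by (auto simp: f_def of_bool_def split: if_splits)
  then show ?thesis using sub by blast
qed

section \<open>Arithmetic of the three cases\<close>

theorem theorem4p1:
  fixes V :: "'a set" and G G' :: "'a graph" and v k p :: nat
  assumes "finite V" and "card V = v"
    and "simple_graph G" and "verts G = V"
    and "simple_graph G'" and "verts G' = V"
    and "prime p"
    and "3 \<le> k" and "k + 3 \<le> v"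
  shows
    "((\<forall>K \<in> [V]\<^bsup>k\<^esup>. h3 (induced_subgraph G K) = h3 (induced_subgraph G' K))
        \<longrightarrow> homogeneous3 G = homogeneous3 G') \<and>
     (5 \<le> p \<and> \<not> [k = 1] (mod p) \<and> \<not> [k = 2] (mod p) \<and>
      (\<forall>K \<in> [V]\<^bsup>k\<^esup>. [h3 (induced_subgraph G K) = h3 (induced_subgraph G' K)] (mod p))
        \<longrightarrow> homogeneous3 G = homogeneous3 G') \<and>
     ((p = 2 \<and> [k = 3] (mod 4) \<or> p = 3 \<and> 3 dvd k) \<and>
      (\<forall>K \<in> [V]\<^bsup>k\<^esup>. [h3 (induced_subgraph G K) = h3 (induced_subgraph G' K)] (mod p))
        \<longrightarrow> homogeneous3 G = homogeneous3 G')"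
proof -
  have k: "3 \<le> k" "k + 3 \<le> card V" using assms by auto
  have G: "finite V" "verts G = V" "verts G' = V" using assms by auto
  have two_choose: "2 * ((k - 1) choose 2) = (k - 1) * (k - 2)"
    using times_binomial_minus1_eq[of 2 "k - 1"] by (simp add: numeral_2_eq_2)
  let ?cong = "\<forall>K\<in>[V]\<^bsup>k\<^esup>. [h3 (induced_subgraph G K) = h3 (induced_subgraph G' K)] (mod p)"
  have prime_p: "int p dvd a \<or> int p dvd b" if "int p dvd a * b" for a b
    using assms(7) that by (simp add: prime_dvd_mult_iff)
  have main: "homogeneous3 G = homogeneous3 G'"
    if "\<not> p dvd k - 2" "\<not> p dvd (k - 1) choose 2" "p \<noteq> 2 \<or> \<not> p dvd k choose 3" ?cong
  proof (rule homogeneous3_eq_of_h3_dvd[OF G k prime_p])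
    show "\<bar>int p\<bar> \<noteq> 1" using assms(7) by auto
    show "int p dvd int (h3 (induced_subgraph G K)) - int (h3 (induced_subgraph G' K))"
      if "K \<in> [V]\<^bsup>k\<^esup>" for K
      using \<open>?cong\<close> that by (simp add: cong_iff_dvd_diff flip: cong_int_iff)
  qed (use that in auto)
  have odd_p: "homogeneous3 G = homogeneous3 G'"
    if "p \<noteq> 2" "\<not> p dvd k - 1" "\<not> p dvd k - 2" ?cong
  proof (rule main)
    show "\<not> p dvd (k - 1) choose 2"
    proof
      assume "p dvd (k - 1) choose 2"
      then have "p dvd (k - 1) * (k - 2)" by (metis dvd_mult two_choose)
      then show False using assms(7) that by (simp add: prime_dvd_mult_iff)
    qed
  qed (use that in auto)
  have part1: "homogeneous3 G = homogeneous3 G'"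
    if "\<forall>K\<in>[V]\<^bsup>k\<^esup>. h3 (induced_subgraph G K) = h3 (induced_subgraph G' K)"
    \<comment> \<open>Divisibility by 0 means being zero, and \<open>k \<ge> 3\<close> keeps the
      binomials positive.\<close>
    by (rule homogeneous3_eq_of_h3_dvd[OF G k, of 0]) (use that k in auto)
  have part2: "homogeneous3 G = homogeneous3 G'"
    if "5 \<le> p" "\<not> [k = 1] (mod p)" "\<not> [k = 2] (mod p)" ?cong
  proof (rule odd_p)
    show "\<not> p dvd k - 1" "\<not> p dvd k - 2" using that k by (simp_all add: cong_altdef_nat)
  qed (use that in auto)
  have part3: "homogeneous3 G = homogeneous3 G'"
    if "p = 2 \<and> [k = 3] (mod 4) \<or> p = 3 \<and> 3 dvd k" ?cong
    using that(1)
  proof (elim disjE conjE)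
    assume "p = 2" "[k = 3] (mod 4)"
    then obtain j where j: "k = 4 * j + 3"
      using k(1) by (metis add.commute cong_le_nat mult.commute)
    have "2 * ((k - 1) choose 2) = 2 * ((2 * j + 1) * (4 * j + 1))"
      unfolding two_choose by (simp add: j)
    then have "(k - 1) choose 2 = (2 * j + 1) * (4 * j + 1)"
      by (metis nat_mult_eq_cancel1 zero_less_numeral)
    then have odd2: "odd ((k - 1) choose 2)" by (simp only:) simp
    \<comment> \<open>Parity passes from \<open>(k - 1) choose 2\<close> to
      \<open>k choose 3\<close>, since \<open>k\<close> is odd.\<close>
    have "3 * (k choose 3) = k * ((k - 1) choose 2)"
      using times_binomial_minus1_eq[of 3 k] by simp
    moreover have "odd (k * ((k - 1) choose 2))" using odd2 j by simp
    ultimately have "odd (k choose 3)" by (metis dvd_mult)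
    then show ?thesis using \<open>p = 2\<close> odd2 j \<open>?cong\<close> by (intro main) auto
  next
    assume "p = 3" "3 dvd k"
    \<comment> \<open>Here \<open>k\<close> avoids the residues 1 and 2, so the argument for odd
      primes applies.\<close>
    then have "\<not> p dvd k - 1" "\<not> p dvd k - 2" using k(1) by presburger+
    then show ?thesis using \<open>p = 3\<close> \<open>?cong\<close> by (intro odd_p) auto
  qed
  show ?thesis using part1 part2 part3 by blast
qed

end
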